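(* Let $\psi\in\mathcal{D}$ be a DQBF and let $\psi_1=\forall x:(\varphi_1\wedge\varphi_2)$ be a subformula of $\psi$ with $x\notin V_{\varphi_1}$. Let $\psi'$ result from $\psi$ by replacing the subformula $\psi_1$ by $\psi_2=(\varphi_1^{-x}\wedge(\forall x:\varphi_2))$, where $\varphi_1^{-x}$ is $\varphi_1$ with $x$ removed from the dependency sets of all its existential variables. Then $\psi$ and $\psi'$ are equisatisfiable.
   Context: Notation: $\mathcal{F}(W)$ is the set of Boolean functions over variable set $W$; $\mathrm{supp}(f)$ the set of variables $f$ depends on. Syntax (non-closed non-prenex DQBFs in NNF over a finite variable set $V$). The set $\mathcal{D}$, with for each $\psi$ the sets $V^{\exists}_\psi$ (existential), $V^{\forall}_\psi$ (universal), $V^{\mathrm{fs}}_\psi$ (free variables occurring in $\psi$), and a dependency set $D_y\subseteq V$ for each existential $y$, is the smallest set closed under: (1) $v\in\mathcal{D}$ for $v\in V$ ($V^\exists=V^\forall=\emptyset$, $V^{\mathrm{fs}}=\{v\}$); (2) $\neg v\in\mathcal{D}$, same sets; (3),(4) if $\varphi_1,\varphi_2\in\mathcal{D}$ and $\bigl(V^Q_{\varphi_1}\cup V^{\mathrm{fs}}_{\varphi_1}\cup\bigcup_{y\in V^\exists_{\varphi_1}}D_y\bigr)\cap V^Q_{\varphi_2}=\emptyset$ and symmetrically, then $(\varphi_1\wedge\varphi_2),(\varphi_1\vee\varphi_2)\in\mathcal{D}$ with all three sets the unions; (5) if $\varphi\in\mathcal{D}$, $v\in V^{\mathrm{free}}_\varphi$,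 $D_v\subseteq V\setminus(V^Q_\varphi\cup\{v\})$, then $\exists v(D_v):\varphi^{-v}\in\mathcal{D}$ ($\varphi^{-v}$: remove $v$ from all dependency sets in $\varphi$), with $V^\exists=V^\exists_\varphi\cup\{v\}$, $V^{\mathrm{fs}}=V^{\mathrm{fs}}_\varphi\setminus\{v\}$; (6) if $\varphi\in\mathcal{D}$, $v\in V^{\mathrm{free}}_\varphi$, then $\forall v:\varphi\in\mathcal{D}$ with $V^\forall=V^\forall_\varphi\cup\{v\}$, $V^{\mathrm{fs}}=V^{\mathrm{fs}}_\varphi\setminus\{v\}$. Here $V^Q_\psi=V^\exists_\psi\cup V^\forall_\psi$, $V_\psi=V^Q_\psi\cup V^{\mathrm{fs}}_\psi$, $V^{\mathrm{free}}_\psi=V\setminus V^Q_\psi$. Semantics. A Skolem function candidate for $\psi$ is a map $s:V^{\mathrm{free}}_\psi\cup V^\exists_\psi\to\mathcal{F}(V^\forall_\psi)$ with $s(v)$ constant for free $v$ and $\mathrm{supp}(s(v))\subseteq D_v\cap V^\forall_\psi$ for existential $v$. $s(\psi)$ replaces each such $v$ by $s(v)$ and deletes quantifiers. $[\![\psi]\!]$ is the set of candidates $s$ with $s(\psi)$ a tautology. $\psi_1\approx\psi_2$ (equisatisfiable) iff $[\![\psi_1]\!]=\emptyset\Leftrightarrow[\![\psi_2]\!]=\emptyset$. *)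

theory Defs
  imports Main "HOL-Library.FuncSet"
begin

section \<open>Non-closed non-prenex DQBFs in negation normal form\<close>

text \<open>Raw syntax trees; the dependency set of an existential variable is stored at its quantifier.
  The DQBFs proper are carved out by the inductive set \<open>DQBF\<close> below.\<close>

datatype 'v dqbf =
    Pos 'v
  | Neg 'v
  | And "'v dqbf" "'v dqbf"
  | Or "'v dqbf" "'v dqbf"
  | Ex 'v "'v set" "'v dqbf"
  | All 'v "'v dqbf"

primrec ex_vars :: "'v dqbf \<Rightarrow> 'v set" where
  "ex_vars (Pos v) = {}"
| "ex_vars (Neg v) = {}"
| "ex_vars (And \<phi>1 \<phi>2) = ex_vars \<phi>1 \<union> ex_vars \<phi>2"
| "ex_vars (Or \<phi>1 \<phi>2) = ex_vars \<phi>1 \<union> ex_vars \<phi>2"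
| "ex_vars (Ex v D \<phi>) = ex_vars \<phi> \<union> {v}"
| "ex_vars (All v \<phi>) = ex_vars \<phi>"

primrec all_vars :: "'v dqbf \<Rightarrow> 'v set" where
  "all_vars (Pos v) = {}"
| "all_vars (Neg v) = {}"
| "all_vars (And \<phi>1 \<phi>2) = all_vars \<phi>1 \<union> all_vars \<phi>2"
| "all_vars (Or \<phi>1 \<phi>2) = all_vars \<phi>1 \<union> all_vars \<phi>2"
| "all_vars (Ex v D \<phi>) = all_vars \<phi>"
| "all_vars (All v \<phi>) = all_vars \<phi> \<union> {v}"

text \<open>Free variables in the support, i.e. free variables that actually occur.\<close>

primrec fs_vars :: "'v dqbf \<Rightarrow> 'v set" where
  "fs_vars (Pos v) = {v}"
| "fs_vars (Neg v) = {v}"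
| "fs_vars (And \<phi>1 \<phi>2) = fs_vars \<phi>1 \<union> fs_vars \<phi>2"
| "fs_vars (Or \<phi>1 \<phi>2) = fs_vars \<phi>1 \<union> fs_vars \<phi>2"
| "fs_vars (Ex v D \<phi>) = fs_vars \<phi> - {v}"
| "fs_vars (All v \<phi>) = fs_vars \<phi> - {v}"

definition q_vars :: "'v dqbf \<Rightarrow> 'v set" where
  "q_vars \<psi> = ex_vars \<psi> \<union> all_vars \<psi>"

definition vars :: "'v dqbf \<Rightarrow> 'v set" where
  "vars \<psi> = q_vars \<psi> \<union> fs_vars \<psi>"

text \<open>All variables of the ambient set \<open>V\<close> that are not quantified, occurring or not.\<close>

definition free_vars :: "'v set \<Rightarrow> 'v dqbf \<Rightarrow> 'v set" where
  "free_vars V \<psi> = V - q_vars \<psi>"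

text \<open>\<open>dep \<psi> y\<close> is the dependency set of \<open>y\<close> in \<open>\<psi>\<close>. It is meaningful for \<open>y \<in> ex_vars \<psi>\<close>;
  in a DQBF such a \<open>y\<close> is quantified exactly once, so the order of the case distinctions
  is irrelevant.\<close>

primrec dep :: "'v dqbf \<Rightarrow> 'v \<Rightarrow> 'v set" where
  "dep (Pos v) y = {}"
| "dep (Neg v) y = {}"
| "dep (And \<phi>1 \<phi>2) y = (if y \<in> ex_vars \<phi>1 then dep \<phi>1 y else dep \<phi>2 y)"
| "dep (Or \<phi>1 \<phi>2) y = (if y \<in> ex_vars \<phi>1 then dep \<phi>1 y else dep \<phi>2 y)"
| "dep (Ex v D \<phi>) y = (if y = v then D else dep \<phi> y)"
| "dep (All v \<phi>) y = dep \<phi> y"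

text \<open>\<open>remove_dep v \<phi>\<close> is \<open>\<phi>\<close> with \<open>v\<close> removed from all dependency sets.\<close>

primrec remove_dep :: "'v \<Rightarrow> 'v dqbf \<Rightarrow> 'v dqbf" where
  "remove_dep v (Pos w) = Pos w"
| "remove_dep v (Neg w) = Neg w"
| "remove_dep v (And \<phi>1 \<phi>2) = And (remove_dep v \<phi>1) (remove_dep v \<phi>2)"
| "remove_dep v (Or \<phi>1 \<phi>2) = Or (remove_dep v \<phi>1) (remove_dep v \<phi>2)"
| "remove_dep v (Ex y D \<phi>) = Ex y (D - {v}) (remove_dep v \<phi>)"
| "remove_dep v (All y \<phi>) = All y (remove_dep v \<phi>)"

definition compatible :: "'v dqbf \<Rightarrow> 'v dqbf \<Rightarrow> bool" where
  "compatible \<phi>1 \<phi>2 \<longleftrightarrow>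
     (q_vars \<phi>1 \<union> fs_vars \<phi>1 \<union> (\<Union>y\<in>ex_vars \<phi>1. dep \<phi>1 y)) \<inter> q_vars \<phi>2 = {} \<and>
     (q_vars \<phi>2 \<union> fs_vars \<phi>2 \<union> (\<Union>y\<in>ex_vars \<phi>2. dep \<phi>2 y)) \<inter> q_vars \<phi>1 = {}"

inductive_set DQBF :: "'v set \<Rightarrow> 'v dqbf set" for V :: "'v set" where
  pos: "v \<in> V \<Longrightarrow> Pos v \<in> DQBF V"
| neg: "v \<in> V \<Longrightarrow> Neg v \<in> DQBF V"
| conj: "\<phi>1 \<in> DQBF V \<Longrightarrow> \<phi>2 \<in> DQBF V \<Longrightarrow> compatible \<phi>1 \<phi>2 \<Longrightarrow> And \<phi>1 \<phi>2 \<in> DQBF V"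
| disj: "\<phi>1 \<in> DQBF V \<Longrightarrow> \<phi>2 \<in> DQBF V \<Longrightarrow> compatible \<phi>1 \<phi>2 \<Longrightarrow> Or \<phi>1 \<phi>2 \<in> DQBF V"
| ex: "\<phi> \<in> DQBF V \<Longrightarrow> v \<in> free_vars V \<phi> \<Longrightarrow> D \<subseteq> V - (q_vars \<phi> \<union> {v})
         \<Longrightarrow> Ex v D (remove_dep v \<phi>) \<in> DQBF V"
| all: "\<phi> \<in> DQBF V \<Longrightarrow> v \<in> free_vars V \<phi> \<Longrightarrow> All v \<phi> \<in> DQBF V"

text \<open>\<open>replace_sub \<sigma> \<tau> \<psi> \<psi>'\<close>: \<open>\<sigma>\<close> is a subformula of \<open>\<psi>\<close>, and \<open>\<psi>'\<close> results from \<open>\<psi>\<close> by replacing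
  one occurrence of \<open>\<sigma>\<close> by \<open>\<tau>\<close>. (In a DQBF, a subformula containing a quantifier
  occurs only once.)\<close>

inductive replace_sub :: "'v dqbf \<Rightarrow> 'v dqbf \<Rightarrow> 'v dqbf \<Rightarrow> 'v dqbf \<Rightarrow> bool"
  for \<sigma> \<tau> :: "'v dqbf" where
  here: "replace_sub \<sigma> \<tau> \<sigma> \<tau>"
| and_left: "replace_sub \<sigma> \<tau> \<phi> \<phi>' \<Longrightarrow> replace_sub \<sigma> \<tau> (And \<phi> \<chi>) (And \<phi>' \<chi>)"
| and_right: "replace_sub \<sigma> \<tau> \<phi> \<phi>' \<Longrightarrow> replace_sub \<sigma> \<tau> (And \<chi> \<phi>) (And \<chi> \<phi>')"
| or_left: "replace_sub \<sigma> \<tau> \<phi> \<phi>' \<Longrightarrow> replace_sub \<sigma> \<tau> (Or \<phi> \<chi>) (Or \<phi>' \<chi>)"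
| or_right: "replace_sub \<sigma> \<tau> \<phi> \<phi>' \<Longrightarrow> replace_sub \<sigma> \<tau> (Or \<chi> \<phi>) (Or \<chi> \<phi>')"
| ex_body: "replace_sub \<sigma> \<tau> \<phi> \<phi>' \<Longrightarrow> replace_sub \<sigma> \<tau> (Ex v D \<phi>) (Ex v D \<phi>')"
| all_body: "replace_sub \<sigma> \<tau> \<phi> \<phi>' \<Longrightarrow> replace_sub \<sigma> \<tau> (All v \<phi>) (All v \<phi>')"


section \<open>Semantics\<close>

text \<open>Boolean functions over \<open>W\<close> are represented on total assignments, with the value determined
  by the restriction of the assignment to \<open>W\<close>.\<close>

type_synonym 'v bool_fun = "('v \<Rightarrow> bool) \<Rightarrow> bool"

definition bool_funs :: "'v set \<Rightarrow> 'v bool_fun set" where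
  "bool_funs W = {f. \<forall>\<mu> \<mu>'. (\<forall>w\<in>W. \<mu> w = \<mu>' w) \<longrightarrow> f \<mu> = f \<mu>'}"

definition supp :: "'v bool_fun \<Rightarrow> 'v set" where
  "supp f = {v. \<exists>\<mu>. f (\<mu>(v := False)) \<noteq> f (\<mu>(v := True))}"

definition skolem_candidates :: "'v set \<Rightarrow> 'v dqbf \<Rightarrow> ('v \<Rightarrow> 'v bool_fun) set" where
  "skolem_candidates V \<psi> =
     {s \<in> (free_vars V \<psi> \<union> ex_vars \<psi>) \<rightarrow>\<^sub>E bool_funs (all_vars \<psi>).
        (\<forall>v\<in>free_vars V \<psi>. \<exists>b. s v = (\<lambda>\<mu>. b)) \<and>
        (\<forall>v\<in>ex_vars \<psi>. supp (s v) \<subseteq> dep \<psi> v \<inter> all_vars \<psi>)}"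

text \<open>\<open>subst_skolem W s \<phi>\<close> is the Boolean function denoted by \<open>\<phi>\<close> after replacing every \<open>v \<in> W\<close>
  by \<open>s v\<close> and deleting all quantifiers.\<close>

primrec subst_skolem :: "'v set \<Rightarrow> ('v \<Rightarrow> 'v bool_fun) \<Rightarrow> 'v dqbf \<Rightarrow> 'v bool_fun" where
  "subst_skolem W s (Pos v) \<mu> = (if v \<in> W then s v \<mu> else \<mu> v)"
| "subst_skolem W s (Neg v) \<mu> = (\<not> (if v \<in> W then s v \<mu> else \<mu> v))"
| "subst_skolem W s (And \<phi>1 \<phi>2) \<mu> = (subst_skolem W s \<phi>1 \<mu> \<and> subst_skolem W s \<phi>2 \<mu>)"
| "subst_skolem W s (Or \<phi>1 \<phi>2) \<mu> = (subst_skolem W s \<phi>1 \<mu> \<or> subst_skolem W s \<phi>2 \<mu>)"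
| "subst_skolem W s (Ex v D \<phi>) \<mu> = subst_skolem W s \<phi> \<mu>"
| "subst_skolem W s (All v \<phi>) \<mu> = subst_skolem W s \<phi> \<mu>"

definition sem :: "'v set \<Rightarrow> 'v dqbf \<Rightarrow> ('v \<Rightarrow> 'v bool_fun) set" where
  "sem V \<psi> = {s \<in> skolem_candidates V \<psi>.
     \<forall>\<mu>. subst_skolem (free_vars V \<psi> \<union> ex_vars \<psi>) s \<psi> \<mu>}"

definition equisatisfiable :: "'v set \<Rightarrow> 'v dqbf \<Rightarrow> 'v dqbf \<Rightarrow> bool" where
  "equisatisfiable V \<psi>1 \<psi>2 \<longleftrightarrow> (sem V \<psi>1 = {} \<longleftrightarrow> sem V \<psi>2 = {})"

end

theory Submission
  imports Defs
begin

text \<open>The variables of \<open>\<psi>\<close> and \<open>\<psi>'\<close> agree and dependency sets only shrink, so Skolem functions of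
  \<open>\<psi>'\<close> are Skolem functions of \<open>\<psi>\<close>. Conversely, given Skolem functions of \<open>\<psi>\<close>, fix \<open>x\<close> to false in
  those of the existential variables of \<open>\<phi>1\<close>. Scoping guarantees that nothing outside the replaced
  subformula depends on \<open>x\<close>. Hence, if the context needs the subformula to be true at an assignment,
  then \<open>\<phi>1 \<and> \<phi>2\<close> holds there for both values of \<open>x\<close>; the value false settles the modified \<open>\<phi>1\<close>, and
  \<open>\<phi>2\<close> is untouched.\<close>

section \<open>Removing a variable from the dependency sets\<close>

lemma ex_vars_remove_dep [simp]: "ex_vars (remove_dep x \<phi>) = ex_vars \<phi>"
  by (induction \<phi>) auto

lemma all_vars_remove_dep [simp]: "all_vars (remove_dep x \<phi>) = all_vars \<phi>"
  by (induction \<phi>) auto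

lemma q_vars_remove_dep [simp]: "q_vars (remove_dep x \<phi>) = q_vars \<phi>"
  by (simp add: q_vars_def)

lemma fs_vars_remove_dep [simp]: "fs_vars (remove_dep x \<phi>) = fs_vars \<phi>"
  by (induction \<phi>) auto

lemma free_vars_remove_dep [simp]: "free_vars V (remove_dep x \<phi>) = free_vars V \<phi>"
  by (simp add: free_vars_def)

lemma dep_remove_dep [simp]: "dep (remove_dep x \<phi>) y = dep \<phi> y - {x}"
  by (induction \<phi>) auto

lemma subst_skolem_remove_dep [simp]:
  "subst_skolem W s (remove_dep x \<phi>) \<mu> = subst_skolem W s \<phi> \<mu>"
  by (induction \<phi>) auto

lemma remove_dep_commute: "remove_dep x (remove_dep y \<phi>) = remove_dep y (remove_dep x \<phi>)"
  by (induction \<phi>) auto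

lemma compatible_remove_dep:
  "compatible \<phi>1 \<phi>2 \<Longrightarrow> compatible (remove_dep x \<phi>1) (remove_dep x \<phi>2)"
  unfolding compatible_def by auto

lemma DQBF_remove_dep: "\<phi> \<in> DQBF V \<Longrightarrow> remove_dep x \<phi> \<in> DQBF V"
proof (induction rule: DQBF.induct)
  case (ex \<phi> v D)
  \<comment> \<open>The formation rule only admits bodies of the form \<open>remove_dep v _\<close>,
    so the removal of \<open>x\<close> is performed inside first and the two removals are swapped
    afterwards.\<close>
  have "Ex v (D - {x}) (remove_dep v (remove_dep x \<phi>)) \<in> DQBF V"
    using ex by (intro DQBF.ex) auto
  then show ?case by (simp add: remove_dep_commute)
qed (auto intro: DQBF.intros compatible_remove_dep)

section \<open>Scoping in DQBFs\<close>

inductive_cases AndE: "And \<phi>1 \<phi>2 \<in> DQBF V"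
inductive_cases OrE: "Or \<phi>1 \<phi>2 \<in> DQBF V"
inductive_cases AllE: "All v \<phi> \<in> DQBF V"

lemma DQBF_And:
  "And \<phi>1 \<phi>2 \<in> DQBF V \<longleftrightarrow> \<phi>1 \<in> DQBF V \<and> \<phi>2 \<in> DQBF V \<and> compatible \<phi>1 \<phi>2"
  by (blast elim: AndE intro: DQBF.conj)

lemma DQBF_Or:
  "Or \<phi>1 \<phi>2 \<in> DQBF V \<longleftrightarrow> \<phi>1 \<in> DQBF V \<and> \<phi>2 \<in> DQBF V \<and> compatible \<phi>1 \<phi>2"
  by (blast elim: OrE intro: DQBF.disj)

lemma DQBF_All: "All v \<phi> \<in> DQBF V \<longleftrightarrow> \<phi> \<in> DQBF V \<and> v \<in> free_vars V \<phi>"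
  by (blast elim: AllE intro: DQBF.all)

text \<open>The body has the form \<open>remove_dep v _\<close>, so it is a DQBF by closure under
  removal. Unlike for the other connectives there is no converse: a DQBF whose dependency sets
  mention \<open>v\<close> cannot be such a body.\<close>

lemma DQBF_ExD:
  assumes "Ex v D \<phi> \<in> DQBF V"
  shows "\<phi> \<in> DQBF V" "v \<in> free_vars V \<phi>" "D \<subseteq> V - (q_vars \<phi> \<union> {v})"
  using assms by (cases; auto intro: DQBF_remove_dep)+

section \<open>Effect of a replacement on quantified variables and dependency sets\<close>

lemma DQBF_replaced: "replace_sub \<sigma> \<tau> \<psi> \<psi>' \<Longrightarrow> \<psi> \<in> DQBF V \<Longrightarrow> \<sigma> \<in> DQBF V"
  by (induction rule: replace_sub.induct) (auto simp: DQBF_And DQBF_Or DQBF_All dest: DQBF_ExD(1))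

lemma ex_vars_replaced: "replace_sub \<sigma> \<tau> \<psi> \<psi>' \<Longrightarrow> ex_vars \<sigma> \<subseteq> ex_vars \<psi>"
  by (induction rule: replace_sub.induct) auto

lemma all_vars_replaced: "replace_sub \<sigma> \<tau> \<psi> \<psi>' \<Longrightarrow> all_vars \<sigma> \<subseteq> all_vars \<psi>"
  by (induction rule: replace_sub.induct) auto

lemma q_vars_replaced: "replace_sub \<sigma> \<tau> \<psi> \<psi>' \<Longrightarrow> q_vars \<sigma> \<subseteq> q_vars \<psi>"
  using ex_vars_replaced all_vars_replaced unfolding q_vars_def by blast

lemma ex_vars_replace_sub:
  "replace_sub \<sigma> \<tau> \<psi> \<psi>' \<Longrightarrow> ex_vars \<sigma> = ex_vars \<tau> \<Longrightarrow> ex_vars \<psi>' = ex_vars \<psi>"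
  by (induction rule: replace_sub.induct) auto

lemma all_vars_replace_sub:
  "replace_sub \<sigma> \<tau> \<psi> \<psi>' \<Longrightarrow> all_vars \<sigma> = all_vars \<tau> \<Longrightarrow> all_vars \<psi>' = all_vars \<psi>"
  by (induction rule: replace_sub.induct) auto

lemma dep_replace_sub_mono:
  assumes "replace_sub \<sigma> \<tau> \<psi> \<psi>'" "ex_vars \<sigma> = ex_vars \<tau>" "dep \<tau> y \<subseteq> dep \<sigma> y"
  shows "dep \<psi>' y \<subseteq> dep \<psi> y"
  using assms
proof (induction rule: replace_sub.induct)
  \<comment> \<open>\<open>dep\<close> decides by membership in \<open>ex_vars\<close> of the left
    operand, so a change there must be known to preserve \<open>ex_vars\<close>.\<close>
  case (and_left \<phi> \<phi>' \<chi>)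
  then show ?case using ex_vars_replace_sub[OF and_left.hyps and_left.prems(1)] by auto
next
  case (or_left \<phi> \<phi>' \<chi>)
  then show ?case using ex_vars_replace_sub[OF or_left.hyps or_left.prems(1)] by auto
qed auto

text \<open>\<open>B\<close> collects what the replacement may take away. It is used with
  \<open>{x}\<close> for arbitrary \<open>y\<close> and with \<open>{}\<close> for \<open>y\<close>
  not existential in \<open>\<phi>1\<close>.\<close>

lemma dep_replace_sub_antimono:
  assumes "replace_sub \<sigma> \<tau> \<psi> \<psi>'" "ex_vars \<sigma> = ex_vars \<tau>" "dep \<sigma> y - B \<subseteq> dep \<tau> y"
  shows "dep \<psi> y - B \<subseteq> dep \<psi>' y"
  using assms
proof (induction rule: replace_sub.induct)
  case (and_left \<phi> \<phi>' \<chi>)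
  then show ?case using ex_vars_replace_sub[OF and_left.hyps and_left.prems(1)] by auto
next
  case (or_left \<phi> \<phi>' \<chi>)
  then show ?case using ex_vars_replace_sub[OF or_left.hyps or_left.prems(1)] by auto
qed auto

lemma compatible_sym: "compatible \<phi> \<chi> \<Longrightarrow> compatible \<chi> \<phi>"
  by (simp add: compatible_def)

lemma compatible_exD:
  assumes "compatible \<phi> \<chi>" "y \<in> ex_vars \<chi>"
  shows "y \<notin> ex_vars \<phi>" "dep \<chi> y \<inter> q_vars \<phi> = {}"
proof -
  have "ex_vars \<chi> \<inter> q_vars \<phi> = {}" "(\<Union>z\<in>ex_vars \<chi>. dep \<chi> z) \<inter> q_vars \<phi> = {}"
    using assms(1) by (auto simp: compatible_def q_vars_def)
  with assms(2) show "y \<notin> ex_vars \<phi>" "dep \<chi> y \<inter> q_vars \<phi> = {}"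
    by (auto simp: q_vars_def)
qed

text \<open>Such a \<open>y\<close> is bound either in a sibling of an ancestor of
  \<open>\<sigma>\<close>, where compatibility keeps its dependencies away from the other operand's
  quantified variables, or by a quantifier above \<open>\<sigma>\<close>, whose dependency set
  avoids everything quantified in its body.\<close>

lemma dep_outside_replaced:
  assumes "replace_sub \<sigma> \<tau> \<psi> \<psi>'" "\<psi> \<in> DQBF V" "y \<in> ex_vars \<psi>" "y \<notin> ex_vars \<sigma>"
  shows "dep \<psi> y \<inter> q_vars \<sigma> = {}"
  using assms(1,2,3)
proof (induction rule: replace_sub.induct)
  case here
  then show ?case using assms(4) by simp
next
  case (and_left \<phi> \<phi>' \<chi>)
  have comp: "compatible \<phi> \<chi>"
    using and_left.prems(1) by (simp add: DQBF_And)
  show ?case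
  proof (cases "y \<in> ex_vars \<chi>")
    case True
    show ?thesis
      using compatible_exD[OF comp True] q_vars_replaced[OF and_left.hyps] True by auto
  next
    case False
    have "dep \<phi> y \<inter> q_vars \<sigma> = {}"
      by (rule and_left.IH) (use and_left.prems False in \<open>simp_all add: DQBF_And\<close>)
    then show ?thesis using False and_left.prems(2) by simp
  qed
next
  case (and_right \<phi> \<phi>' \<chi>)
  have comp: "compatible \<phi> \<chi>"
    using and_right.prems(1) by (simp add: DQBF_And compatible_sym)
  show ?case
  proof (cases "y \<in> ex_vars \<chi>")
    case True
    show ?thesis
      using compatible_exD[OF comp True] q_vars_replaced[OF and_right.hyps] True by auto
  next
    case False
    have "dep \<phi> y \<inter> q_vars \<sigma> = {}"
      by (rule and_right.IH) (use and_right.prems False in \<open>simp_all add: DQBF_And\<close>)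
    then show ?thesis using False and_right.prems(2) by simp
  qed
next
  case (or_left \<phi> \<phi>' \<chi>)
  have comp: "compatible \<phi> \<chi>"
    using or_left.prems(1) by (simp add: DQBF_Or)
  show ?case
  proof (cases "y \<in> ex_vars \<chi>")
    case True
    show ?thesis
      using compatible_exD[OF comp True] q_vars_replaced[OF or_left.hyps] True by auto
  next
    case False
    have "dep \<phi> y \<inter> q_vars \<sigma> = {}"
      by (rule or_left.IH) (use or_left.prems False in \<open>simp_all add: DQBF_Or\<close>)
    then show ?thesis using False or_left.prems(2) by simp
  qed
next
  case (or_right \<phi> \<phi>' \<chi>)
  have comp: "compatible \<phi> \<chi>"
    using or_right.prems(1) by (simp add: DQBF_Or compatible_sym)
  show ?case
  proof (cases "y \<in> ex_vars \<chi>")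
    case True
    show ?thesis
      using compatible_exD[OF comp True] q_vars_replaced[OF or_right.hyps] True by auto
  next
    case False
    have "dep \<phi> y \<inter> q_vars \<sigma> = {}"
      by (rule or_right.IH) (use or_right.prems False in \<open>simp_all add: DQBF_Or\<close>)
    then show ?thesis using False or_right.prems(2) by simp
  qed
next
  case (ex_body \<phi> \<phi>' v D)
  show ?case
  proof (cases "y = v")
    case True
    then show ?thesis
      using DQBF_ExD(3)[OF ex_body.prems(1)] q_vars_replaced[OF ex_body.hyps] by auto
  next
    case False
    have "dep \<phi> y \<inter> q_vars \<sigma> = {}"
      by (rule ex_body.IH) (use ex_body.prems False in \<open>auto dest: DQBF_ExD(1)\<close>)
    then show ?thesis using False by simp
  qed
next
  case (all_body \<phi> \<phi>' v)
  then show ?case by (simp add: DQBF_All)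
qed

section \<open>Semantic lemmas\<close>

lemma supp_indep: "x \<notin> supp f \<Longrightarrow> f (\<mu>(x := b)) = f \<mu>"
proof -
  assume "x \<notin> supp f"
  then have "f (\<mu>(x := False)) = f (\<mu>(x := True))" by (simp add: supp_def)
  then have "f (\<mu>(x := b)) = f (\<mu>(x := \<mu> x))" by (cases b; cases "\<mu> x") auto
  then show ?thesis by simp
qed

lemma supp_fix_subset: "supp (\<lambda>\<mu>. f (\<mu>(x := b))) \<subseteq> supp f - {x}"
proof
  fix v assume "v \<in> supp (\<lambda>\<mu>. f (\<mu>(x := b)))"
  then obtain \<mu> where \<mu>: "f (\<mu>(v := False, x := b)) \<noteq> f (\<mu>(v := True, x := b))"
    by (auto simp: supp_def)
  \<comment> \<open>For \<open>v = x\<close> the outer update would overwrite the inner one and the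
    two values would coincide.\<close>
  then have "v \<noteq> x" by auto
  then have "f ((\<mu>(x := b))(v := False)) \<noteq> f ((\<mu>(x := b))(v := True))"
    using \<mu> by (simp only: fun_upd_twist[OF \<open>v \<noteq> x\<close>] not_False_eq_True)
  then show "v \<in> supp f - {x}"
    using \<open>v \<noteq> x\<close> unfolding supp_def by blast
qed

text \<open>Functions and assignment may change simultaneously, which allows comparing
  \<open>s\<close> at \<open>\<mu>(x := False)\<close> with \<open>s'\<close> at
  \<open>\<mu>\<close>.\<close>

lemma subst_skolem_cong:
  assumes "\<And>v. v \<in> vars \<phi> \<Longrightarrow> v \<in> W \<Longrightarrow> s v \<mu> = s' v \<mu>'"
    and "\<And>v. v \<in> vars \<phi> \<Longrightarrow> v \<notin> W \<Longrightarrow> \<mu> v = \<mu>' v"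
  shows "subst_skolem W s \<phi> \<mu> = subst_skolem W s' \<phi> \<mu>'"
  using assms
proof (induction \<phi>)
  case (Ex v D \<phi>)
  have "vars \<phi> \<subseteq> vars (Ex v D \<phi>)" by (auto simp: vars_def q_vars_def)
  then show ?case using Ex by (auto simp: subset_iff)
next
  case (All v \<phi>)
  have "vars \<phi> \<subseteq> vars (All v \<phi>)" by (auto simp: vars_def q_vars_def)
  then show ?case using All by (auto simp: subset_iff)
next
  case (And \<phi>1 \<phi>2)
  have "vars (And \<phi>1 \<phi>2) = vars \<phi>1 \<union> vars \<phi>2" by (auto simp: vars_def q_vars_def)
  then show ?case using And by auto
next
  case (Or \<phi>1 \<phi>2)
  have "vars (Or \<phi>1 \<phi>2) = vars \<phi>1 \<union> vars \<phi>2" by (auto simp: vars_def q_vars_def)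
  then show ?case using Or by auto
qed (auto simp: vars_def)

text \<open>Assuming \<open>\<psi>\<close> at both values of \<open>x\<close> makes the induction go through disjunctions: a sibling
  disjunct does not depend on \<open>x\<close>, so the replaced disjunct is either not needed at all or true for
  both values.\<close>

lemma subst_skolem_replace_sub:
  assumes "replace_sub \<sigma> \<tau> \<psi> \<psi>'" "\<psi> \<in> DQBF V" "x \<in> q_vars \<sigma>"
    and indep: "\<And>v \<mu> b. v \<in> W \<Longrightarrow> v \<notin> ex_vars \<sigma> \<Longrightarrow> s v (\<mu>(x := b)) = s v \<mu>"
    and agree: "\<And>v. v \<notin> ex_vars \<sigma> \<Longrightarrow> s' v = s v"
    and local: "(\<And>b. subst_skolem W s \<sigma> (\<mu>(x := b))) \<Longrightarrow> subst_skolem W s' \<tau> \<mu>"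
    and "\<And>b. subst_skolem W s \<psi> (\<mu>(x := b))"
  shows "subst_skolem W s' \<psi>' \<mu>"
proof -
  \<comment> \<open>A formula whose variables avoid those quantified in \<open>\<sigma>\<close>
    contains neither \<open>x\<close> nor a variable whose Skolem function was modified.\<close>
  have sibling: "subst_skolem W s \<chi> (\<mu>(x := b)) = subst_skolem W s' \<chi> \<mu>"
    if "vars \<chi> \<inter> q_vars \<phi> = {}" "replace_sub \<sigma> \<tau> \<phi> \<phi>'" for \<phi> \<phi>' \<chi> b
  proof (rule subst_skolem_cong)
    fix v assume "v \<in> vars \<chi>"
    then have v: "v \<notin> q_vars \<sigma>" using that q_vars_replaced by blast
    then have "v \<notin> ex_vars \<sigma>" "v \<noteq> x" using \<open>x \<in> q_vars \<sigma>\<close> by (auto simp: q_vars_def)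
    then show "v \<in> W \<Longrightarrow> s v (\<mu>(x := b)) = s' v \<mu>" and "v \<notin> W \<Longrightarrow> (\<mu>(x := b)) v = \<mu> v"
      using indep agree by auto
  qed
  show ?thesis
    using assms(1,2,7)
  proof (induction rule: replace_sub.induct)
    case here
    then show ?case using local by blast
  next
    case (and_left \<phi> \<phi>' \<chi>)
    have "vars \<chi> \<inter> q_vars \<phi> = {}"
      using and_left.prems by (auto simp: DQBF_And compatible_def vars_def)
    from sibling[OF this and_left.hyps] and_left show ?case
      by (auto simp: DQBF_And simp del: fun_upd_apply)
  next
    case (and_right \<phi> \<phi>' \<chi>)
    have "vars \<chi> \<inter> q_vars \<phi> = {}"
      using and_right.prems by (auto simp: DQBF_And compatible_def vars_def)
    from sibling[OF this and_right.hyps] and_right show ?case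
      by (auto simp: DQBF_And simp del: fun_upd_apply)
  next
    case (or_left \<phi> \<phi>' \<chi>)
    have "vars \<chi> \<inter> q_vars \<phi> = {}"
      using or_left.prems by (auto simp: DQBF_Or compatible_def vars_def)
    from sibling[OF this or_left.hyps] or_left show ?case
      by (auto simp: DQBF_Or simp del: fun_upd_apply)
  next
    case (or_right \<phi> \<phi>' \<chi>)
    have "vars \<chi> \<inter> q_vars \<phi> = {}"
      using or_right.prems by (auto simp: DQBF_Or compatible_def vars_def)
    from sibling[OF this or_right.hyps] or_right show ?case
      by (auto simp: DQBF_Or simp del: fun_upd_apply)
  next
    case (ex_body \<phi> \<phi>' v D)
    then show ?case using DQBF_ExD(1)[OF ex_body.prems(1)] by simp
  next
    case (all_body \<phi> \<phi>' v)
    then show ?case by (simp add: DQBF_All)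
  qed
qed

lemma subst_skolem_replace_sub_eq:
  assumes "replace_sub \<sigma> \<tau> \<psi> \<psi>'" "subst_skolem W s \<sigma> \<mu> = subst_skolem W s \<tau> \<mu>"
  shows "subst_skolem W s \<psi> \<mu> = subst_skolem W s \<psi>' \<mu>"
  using assms by (induction rule: replace_sub.induct) auto

section \<open>Transfer of Skolem functions between the two formulas\<close>

theorem theorem9:
  fixes V :: "'v set" and \<psi> \<psi>' \<phi>1 \<phi>2 :: "'v dqbf" and x :: 'v
  assumes "finite V"
    and "\<psi> \<in> DQBF V"
    and "x \<notin> vars \<phi>1"
    and "replace_sub (All x (And \<phi>1 \<phi>2)) (And (remove_dep x \<phi>1) (All x \<phi>2)) \<psi> \<psi>'"
  shows "equisatisfiable V \<psi> \<psi>'"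
proof -
  define \<sigma> where "\<sigma> = All x (And \<phi>1 \<phi>2)"
  define \<tau> where "\<tau> = And (remove_dep x \<phi>1) (All x \<phi>2)"
  have rep: "replace_sub \<sigma> \<tau> \<psi> \<psi>'" using assms(4) by (simp add: \<sigma>_def \<tau>_def)
  have ex_eq: "ex_vars \<sigma> = ex_vars \<tau>" and all_eq: "all_vars \<sigma> = all_vars \<tau>"
    by (auto simp: \<sigma>_def \<tau>_def)
  have ex [simp]: "ex_vars \<psi>' = ex_vars \<psi>" and all [simp]: "all_vars \<psi>' = all_vars \<psi>"
    using ex_vars_replace_sub[OF rep ex_eq] all_vars_replace_sub[OF rep all_eq] by auto
  have free [simp]: "free_vars V \<psi>' = free_vars V \<psi>"
    by (simp add: free_vars_def q_vars_def)
  have dep_mono: "dep \<psi>' y \<subseteq> dep \<psi> y" for y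
    by (rule dep_replace_sub_mono[OF rep ex_eq]) (auto simp: \<sigma>_def \<tau>_def)
  have dep_sub: "dep \<psi> y - {x} \<subseteq> dep \<psi>' y" for y
    by (rule dep_replace_sub_antimono[OF rep ex_eq]) (auto simp: \<sigma>_def \<tau>_def)
  have dep_same: "dep \<psi> y \<subseteq> dep \<psi>' y" if "y \<notin> ex_vars \<phi>1" for y
    using dep_replace_sub_antimono[OF rep ex_eq, of y "{}"] that by (auto simp: \<sigma>_def \<tau>_def)
  have sub: "\<sigma> \<in> DQBF V" using DQBF_replaced[OF rep assms(2)] .
  then have compat: "compatible \<phi>1 \<phi>2" by (simp add: \<sigma>_def DQBF_All DQBF_And)
  have xq: "x \<in> q_vars \<sigma>" by (simp add: \<sigma>_def q_vars_def)
  define W where "W = free_vars V \<psi> \<union> ex_vars \<psi>"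
  have ex1: "ex_vars \<phi>1 \<subseteq> ex_vars \<psi>" using ex_vars_replaced[OF rep] by (simp add: \<sigma>_def)

  have "s \<in> sem V \<psi>" if "s \<in> sem V \<psi>'" for s
  proof -
    \<comment> \<open>Once quantifiers are deleted, \<open>\<sigma>\<close> and
      \<open>\<tau>\<close> have the same matrix.\<close>
    have "subst_skolem W s \<psi> = subst_skolem W s \<psi>'"
      by (intro ext subst_skolem_replace_sub_eq[OF rep]) (simp add: \<sigma>_def \<tau>_def)
    then have "\<forall>\<mu>. subst_skolem W s \<psi> \<mu>" using that by (simp add: sem_def W_def)
    moreover have "s \<in> skolem_candidates V \<psi>"
      using that dep_mono
      by (simp add: sem_def skolem_candidates_def) (meson subset_trans)
    ultimately show ?thesis by (simp add: sem_def W_def)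
  qed
  moreover have "\<exists>s'. s' \<in> sem V \<psi>'" if s: "s \<in> sem V \<psi>" for s
  proof -
    \<comment> \<open>Only the functions of \<open>\<phi>1\<close> are changed: those of
      \<open>\<phi>2\<close> may still depend on \<open>x\<close>. The value \<open>False\<close> is
      arbitrary.\<close>
    define s' where
      "s' = (\<lambda>y. if y \<in> ex_vars \<phi>1 then (\<lambda>\<mu>. s y (\<mu>(x := False))) else s y)"
    have s_ext: "s \<in> W \<rightarrow>\<^sub>E bool_funs (all_vars \<psi>)"
      and s_free: "\<And>v. v \<in> free_vars V \<psi> \<Longrightarrow> \<exists>b. s v = (\<lambda>\<mu>. b)"
      and s_supp: "\<And>v. v \<in> ex_vars \<psi> \<Longrightarrow> supp (s v) \<subseteq> dep \<psi> v \<inter> all_vars \<psi>"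
      and s_taut: "\<And>\<mu>. subst_skolem W s \<psi> \<mu>"
      using s by (auto simp: sem_def skolem_candidates_def W_def)
    \<comment> \<open>Existential variables bound outside \<open>\<sigma>\<close> cannot have
      \<open>x\<close> as a dependency, and free variables receive constants.\<close>
    have indep: "s v (\<mu>(x := b)) = s v \<mu>" if "v \<in> W" "v \<notin> ex_vars \<sigma>" for v \<mu> b
    proof (cases "v \<in> ex_vars \<psi>")
      case True
      then have "x \<notin> dep \<psi> v" using dep_outside_replaced[OF rep assms(2) True that(2)] xq by blast
      then show ?thesis using s_supp[OF True] by (intro supp_indep) auto
    next
      case False
      then show ?thesis using s_free[of v] that by (auto simp: W_def)
    qed
    have "subst_skolem W s' \<psi>' \<mu>" for \<mu>
    proof (rule subst_skolem_replace_sub[OF rep assms(2) xq indep])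
      assume loc: "\<And>b. subst_skolem W s \<sigma> (\<mu>(x := b))"
      have "subst_skolem W s \<phi>1 (\<mu>(x := False)) = subst_skolem W s' \<phi>1 \<mu>"
      proof (rule subst_skolem_cong)
        fix v assume v: "v \<in> vars \<phi>1"
        then show "v \<notin> W \<Longrightarrow> (\<mu>(x := False)) v = \<mu> v" using assms(3) by auto
        assume "v \<in> W"
        \<comment> \<open>Hence \<open>v\<close> is existential in \<open>\<phi>1\<close>, where
          \<open>s'\<close> fixes \<open>x\<close> by definition, or lies outside
          \<open>ex_vars \<sigma>\<close>, where \<open>indep\<close> applies.\<close>
        have "v \<notin> ex_vars \<phi>2" using v compat by (auto simp: compatible_def vars_def q_vars_def)
        then show "s v (\<mu>(x := False)) = s' v \<mu>"
          using indep[OF \<open>v \<in> W\<close>] by (auto simp: s'_def \<sigma>_def)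
      qed
      moreover have "subst_skolem W s \<phi>2 \<mu> = subst_skolem W s' \<phi>2 \<mu>"
        using compat
        by (intro subst_skolem_cong) (auto simp: s'_def compatible_def vars_def q_vars_def)
      \<comment> \<open>Two instances of \<open>loc\<close> are used: the current value of
        \<open>x\<close> supplies \<open>\<phi>2\<close> at \<open>\<mu>\<close>, the value
        \<open>False\<close> supplies \<open>\<phi>1\<close>.\<close>
      moreover have "subst_skolem W s \<sigma> \<mu>" using loc[of "\<mu> x"] by simp
      ultimately show "subst_skolem W s' \<tau> \<mu>"
        using loc[of False] by (simp add: \<sigma>_def \<tau>_def)
    next
      show "s' v = s v" if "v \<notin> ex_vars \<sigma>" for v using that by (auto simp: s'_def \<sigma>_def)
    qed (use s_taut in auto)
    moreover have "s' \<in> skolem_candidates V \<psi>'"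
    proof -
      have "s' \<in> W \<rightarrow>\<^sub>E bool_funs (all_vars \<psi>)"
      proof (rule PiE_I)
        fix v assume "v \<in> W"
        then have "s v \<in> bool_funs (all_vars \<psi>)" using s_ext by auto
        then show "s' v \<in> bool_funs (all_vars \<psi>)" by (simp add: s'_def bool_funs_def)
      next
        fix v assume "v \<notin> W"
        \<comment> \<open>\<open>ex1\<close> ensures that \<open>s'\<close> alters nothing outside
          \<open>W\<close>, so extensionality is inherited from \<open>s\<close>.\<close>
        then show "s' v = undefined" using s_ext ex1 by (auto simp: s'_def W_def)
      qed
      moreover have "\<exists>b. s' v = (\<lambda>\<mu>. b)" if "v \<in> free_vars V \<psi>" for v
        using s_free[OF that] by (auto simp: s'_def)
      moreover have "supp (s' v) \<subseteq> dep \<psi>' v \<inter> all_vars \<psi>" if v: "v \<in> ex_vars \<psi>" for v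
        \<comment> \<open>In \<open>\<phi>1\<close> the support loses \<open>x\<close>, which is all
          that \<open>dep \<psi>'\<close> can have lost; elsewhere nothing was lost.\<close>
        using supp_fix_subset[of "s v" x False] s_supp[OF v] dep_sub[of v] dep_same[of v]
        by (auto simp: s'_def)
      ultimately show ?thesis by (simp add: skolem_candidates_def W_def)
    qed
    ultimately show ?thesis by (auto simp: sem_def W_def)
  qed
  ultimately show ?thesis unfolding equisatisfiable_def by blast
qed

end
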